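(* Let $N>1/2$, and let $h$ be a real-valued summary of datasets with sensitivity $\Delta=\sup_{D\sim D'}|h(D)-h(D')|$. Let $\theta>0$ and let $\sigma>0$ satisfy $$\sigma\ \ge\ \frac{\Delta}{\theta}\left(\frac{N\,\Gamma(2-1/N)}{\Gamma(1+1/N)}\right)^{1/2}.$$ Then the generalized Gaussian mechanism of degree $N$, $$f^N_D(x)=\frac{N}{2\sigma\,\Gamma(1/N)}\exp\left\{-\frac{|x-h(D)|^N}{\sigma^N}\right\},\qquad x\in\mathbb{R},$$ satisfies $\theta$-Rao differential privacy, i.e. $d_R(f^N_D,f^N_{D'})\le\theta$ for all adjacent datasets $D\sim D'$, where $d_R$ is the Rao distance in the family of generalized Gaussian densities with fixed $N$ and $\sigma$.
   Context: $\Gamma$ is the gamma function. Datasets: $D=\{x_1,\dots,x_n\}$ with $x_i\in\mathcal{X}$ and $n$ fixed. Two datasets $D,D'$ are adjacent, written $D\sim D'$, if $|D|=|D'|$ and they differ in exactly one observation. Rao distance: for fixed $N$ and $\sigma>0$ consider the one-parameter family $\{p(\cdot;\mu):\mu\in\mathbb{R}\}$, $p(x;\mu)=\frac{N}{2\sigma\Gamma(1/N)}\exp\{-|x-\mu|^N/\sigma^N\}$. Its Fisher information is $g(\mu)=\mathbb{E}_{x\sim p(\cdot;\mu)}\big[(\partial_\mu\ln p(x;\mu))^2\big]$ (the derivative exists almost everywhere), regarded as a Riemannian metric on the parameter space $\mathbb{R}$. The Rao distance $d_R(p(\cdot;\mu_1),p(\cdot;\mu_2))$ is the Riemannian distance between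 $\mu_1$ and $\mu_2$, i.e. the infimum of $\int_0^1\sqrt{g(\alpha(t))}\,|\dot\alpha(t)|\,dt$ over smooth paths $\alpha:[0,1]\to\mathbb{R}$ with $\alpha(0)=\mu_1$, $\alpha(1)=\mu_2$. Rao differential privacy: a mechanism $f_D$ satisfies $\theta$-Rao differential privacy if $d_R(f_D,f_{D'})\le\theta$ for all $D\sim D'$. *)

theory Defs
  imports "HOL-Analysis.Analysis"
begin

section \<open>Datasets and sensitivity\<close>

text \<open>A dataset is indexed as \<open>x\<^sub>1, \<dots>, x\<^sub>n\<close> and may contain repeated observations. A summary
  that does not depend on the order of the observations is one that factors through \<open>mset\<close>.\<close>

definition datasets :: "nat \<Rightarrow> 'a set \<Rightarrow> 'a list set" where
  "datasets n X = {D. length D = n \<and> set D \<subseteq> X}"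

definition adjacent :: "'a list \<Rightarrow> 'a list \<Rightarrow> bool" where
  "adjacent D D' \<longleftrightarrow>
     length D = length D' \<and> card {i. i < length D \<and> D ! i \<noteq> D' ! i} = 1"

text \<open>The supremum is taken in \<open>[0, \<infinity>]\<close>: it is \<open>\<infinity>\<close> for a summary of unbounded sensitivity
  and \<open>0\<close> if there are no adjacent datasets.\<close>

definition sensitivity :: "nat \<Rightarrow> 'a set \<Rightarrow> ('a list \<Rightarrow> real) \<Rightarrow> ennreal" where
  "sensitivity n X h =
     (SUP (D, D') \<in> {(D, D'). D \<in> datasets n X \<and> D' \<in> datasets n X \<and> adjacent D D'}.
        ennreal \<bar>h D - h D'\<bar>)"

section \<open>Rao distance in a one-parameter family\<close>

text \<open>A family \<open>p\<close> of probability densities on the real line is given as \<open>p \<mu> x\<close>. At the points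
  \<open>x\<close> where the derivative in the parameter does not exist, \<open>deriv\<close> has an unspecified value; for
  the families of interest these points form a null set.\<close>

definition fisher_information :: "(real \<Rightarrow> real \<Rightarrow> real) \<Rightarrow> real \<Rightarrow> real" where
  "fisher_information p \<mu> =
     (\<integral>x. (deriv (\<lambda>m. ln (p m x)) \<mu>)\<^sup>2 \<partial>(density lborel (\<lambda>x. ennreal (p \<mu> x))))"

text \<open>Infinitely differentiable on \<open>[0, 1]\<close>, with one-sided derivatives at the end points.\<close>

definition smooth_path :: "(real \<Rightarrow> real) \<Rightarrow> bool" where
  "smooth_path \<alpha> \<longleftrightarrow>
     (\<forall>k. ((\<lambda>f t. vector_derivative f (at t within {0..1})) ^^ k) \<alpha> differentiable_on {0..1})"

definition path_length :: "(real \<Rightarrow> real) \<Rightarrow> (real \<Rightarrow> real) \<Rightarrow> real" where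
  "path_length g \<alpha> =
     integral {0..1} (\<lambda>t. sqrt (g (\<alpha> t)) * \<bar>vector_derivative \<alpha> (at t within {0..1})\<bar>)"

definition riemannian_distance :: "(real \<Rightarrow> real) \<Rightarrow> real \<Rightarrow> real \<Rightarrow> real" where
  "riemannian_distance g \<mu>1 \<mu>2 =
     Inf {path_length g \<alpha> | \<alpha>. smooth_path \<alpha> \<and> \<alpha> 0 = \<mu>1 \<and> \<alpha> 1 = \<mu>2}"

text \<open>The distance between two members of an identifiable (that is, injectively parametrised)
  family; \<open>inv p f\<close> is the parameter of the density \<open>f\<close>.\<close>

definition rao_distance ::
    "(real \<Rightarrow> real \<Rightarrow> real) \<Rightarrow> (real \<Rightarrow> real) \<Rightarrow> (real \<Rightarrow> real) \<Rightarrow> real" where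
  "rao_distance p f f' = riemannian_distance (fisher_information p) (inv p f) (inv p f')"

text \<open>The output densities are required to belong to the family, since the distance is only
  meaningful there.\<close>

definition rao_differentially_private ::
    "nat \<Rightarrow> 'a set \<Rightarrow> (real \<Rightarrow> real \<Rightarrow> real) \<Rightarrow> real \<Rightarrow> ('a list \<Rightarrow> real \<Rightarrow> real) \<Rightarrow> bool" where
  "rao_differentially_private n X p \<theta> f \<longleftrightarrow>
     (\<forall>D \<in> datasets n X. f D \<in> range p) \<and>
     (\<forall>D \<in> datasets n X. \<forall>D' \<in> datasets n X.
        adjacent D D' \<longrightarrow> rao_distance p (f D) (f D') \<le> \<theta>)"

section \<open>The generalized Gaussian mechanism\<close>

definition gen_gaussian_density :: "real \<Rightarrow> real \<Rightarrow> real \<Rightarrow> real \<Rightarrow> real" where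
  "gen_gaussian_density N \<sigma> \<mu> x =
     N / (2 * \<sigma> * Gamma (1 / N)) * exp (- (\<bar>x - \<mu>\<bar> powr N / \<sigma> powr N))"

definition gen_gaussian_mechanism ::
    "real \<Rightarrow> real \<Rightarrow> ('a list \<Rightarrow> real) \<Rightarrow> 'a list \<Rightarrow> real \<Rightarrow> real" where
  "gen_gaussian_mechanism N \<sigma> h D x = gen_gaussian_density N \<sigma> (h D) x"

end

theory Submission
  imports Defs
begin

text \<open>The Fisher information of the location family is the constant
  \<open>g = N \<Gamma>(2 - 1/N) / (\<sigma>\<^sup>2 \<Gamma>(1 + 1/N))\<close>: on each side of \<open>\<mu>\<close> the substitution
  \<open>t = (\<bar>x - \<mu>\<bar> / \<sigma>)\<^sup>N\<close> turns the second moment of the score into a Gamma integral.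
  The straight path from \<open>h D\<close> to \<open>h D'\<close> has length \<open>\<surd>g \<bar>h D - h D'\<bar>\<close>, which bounds the
  distance and is at most \<open>\<theta>\<close> by the choice of \<open>\<sigma>\<close>.\<close>

section \<open>Fisher information of the generalized Gaussian family\<close>

text \<open>The value at \<open>x = a\<close> gives the location away: there the first density is at
  its peak, so equality forces the exponential factor of the second to be 1. Injectivity lets
  \<open>inv\<close> in \<open>rao_distance\<close> recover the location parameter.\<close>

lemma inj_gen_gaussian_density:
  fixes N \<sigma> :: real
  assumes N: "N > 0" and \<sigma>: "\<sigma> > 0"
  shows "inj (gen_gaussian_density N \<sigma>)"
proof (rule injI)
  fix a b assume eq: "gen_gaussian_density N \<sigma> a = gen_gaussian_density N \<sigma> b"
  have "Gamma (1 / N) > 0"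
    using N by (intro Gamma_real_pos) auto
  hence c: "N / (2 * \<sigma> * Gamma (1 / N)) > 0"
    using N \<sigma> by simp
  from fun_cong[OF eq, of a] have "N / (2 * \<sigma> * Gamma (1 / N)) * 1
      = N / (2 * \<sigma> * Gamma (1 / N)) * exp (- (\<bar>a - b\<bar> powr N / \<sigma> powr N))"
    by (simp add: gen_gaussian_density_def)
  hence "exp (- (\<bar>a - b\<bar> powr N / \<sigma> powr N)) = 1"
    using c by (subst (asm) mult_left_cancel) auto
  hence "\<bar>a - b\<bar> powr N / \<sigma> powr N = 0" by simp
  with \<sigma> show "a = b" by simp
qed

text \<open>For \<open>m\<close> near \<open>\<mu>\<close> the sign of \<open>x - m\<close> does not
  change, so the absolute value resolves to a positive linear function of \<open>m\<close> whose
  power is differentiable. At \<open>x = \<mu>\<close> this breaks down, and for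
  \<open>N \<le> 1\<close> the derivative does not exist there.\<close>

lemma deriv_ln_gen_gaussian_density:
  fixes N \<sigma> \<mu> x :: real
  assumes N: "N > 0" and \<sigma>: "\<sigma> > 0" and x: "x \<noteq> \<mu>"
  shows "deriv (\<lambda>m. ln (gen_gaussian_density N \<sigma> m x)) \<mu>
           = sgn (x - \<mu>) * N * \<bar>x - \<mu>\<bar> powr (N - 1) / \<sigma> powr N"
proof -
  define c where "c = N / (2 * \<sigma> * Gamma (1 / N))"
  have "Gamma (1 / N) > 0"
    using N by (intro Gamma_real_pos) auto
  hence c: "c > 0"
    using N \<sigma> by (simp add: c_def)
  have ln_eq: "ln (gen_gaussian_density N \<sigma> m x) = ln c - \<bar>x - m\<bar> powr N / \<sigma> powr N" for m
    using c by (simp add: gen_gaussian_density_def c_def[symmetric] ln_mult)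
  have "((\<lambda>m. \<bar>x - m\<bar> powr N) has_real_derivative
          - (sgn (x - \<mu>) * N * \<bar>x - \<mu>\<bar> powr (N - 1))) (at \<mu>)"
  proof (cases "x > \<mu>")
    case True
    have "((\<lambda>m. (x - m) powr N) has_real_derivative - (N * (x - \<mu>) powr (N - 1))) (at \<mu>)"
      using True by (auto intro!: derivative_eq_intros)
    moreover have "eventually (\<lambda>m. m < x) (nhds \<mu>)"
      using True by (rule eventually_nhds_in_open[of "{..<x}", simplified])
    ultimately show ?thesis
      using True by (subst DERIV_cong_ev[OF refl _ refl, of _ "\<lambda>m. (x - m) powr N"])
        (auto elim!: eventually_mono)
  next
    case False
    with x have lt: "x < \<mu>" by simp
    have "((\<lambda>m. (m - x) powr N) has_real_derivative N * (\<mu> - x) powr (N - 1)) (at \<mu>)"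
      using lt by (auto intro!: derivative_eq_intros)
    moreover have "eventually (\<lambda>m. m > x) (nhds \<mu>)"
      using lt by (rule eventually_nhds_in_open[of "{x<..}", simplified])
    ultimately show ?thesis
      using lt by (subst DERIV_cong_ev[OF refl _ refl, of _ "\<lambda>m. (m - x) powr N"])
        (auto elim!: eventually_mono)
  qed
  from DERIV_diff[OF DERIV_const[of "ln c"] DERIV_cdivide[OF this, of "\<sigma> powr N"]]
  have "((\<lambda>m. ln c - \<bar>x - m\<bar> powr N / \<sigma> powr N) has_real_derivative
          sgn (x - \<mu>) * N * \<bar>x - \<mu>\<bar> powr (N - 1) / \<sigma> powr N) (at \<mu>)"
    by simp
  thus ?thesis
    unfolding ln_eq by (rule DERIV_imp_deriv)
qed

text \<open>The sign \<open>e\<close> selects the side of \<open>\<mu>\<close>.\<close>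

lemma has_integral_powr_exp_half_line:
  fixes N \<sigma> \<mu> e :: real
  assumes N: "N > 1 / 2" and \<sigma>: "\<sigma> > 0" and e: "e = 1 \<or> e = -1"
  shows "((\<lambda>x. \<bar>x - \<mu>\<bar> powr (2 * N - 2) * exp (- (\<bar>x - \<mu>\<bar> powr N / \<sigma> powr N)))
           has_integral \<sigma> powr (2 * N - 1) / N * Gamma (2 - 1 / N)) {x. e * (x - \<mu>) > 0}"
proof -
  define S where "S = {x. e * (x - \<mu>) > 0}"
  define u where "u x = (e * (x - \<mu>)) powr N / \<sigma> powr N" for x
  define u' where "u' x = e * N * (e * (x - \<mu>)) powr (N - 1) / \<sigma> powr N" for x
  \<comment> \<open>The integrand of the Gamma integral with parameter
    \<open>2 - 1 / N\<close>.\<close>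
  define f where "f t = t powr (2 - 1 / N - 1) / exp t" for t :: real
  have abs_e: "\<bar>e\<bar> = 1" using e by auto
  \<comment> \<open>The bound \<open>N > 1 / 2\<close> enters here: the Gamma integral converges at
    0 only for a positive parameter.\<close>
  have s: "2 - 1 / N > 0" using N by (simp add: field_simps)
  have abs_eq: "\<bar>x - \<mu>\<bar> = e * (x - \<mu>)" if "x \<in> S" for x
    using that e unfolding S_def by auto
  have "S \<in> sets borel"
    unfolding S_def by measurable
  hence S: "S \<in> sets lebesgue" by simp
  have der: "(u has_field_derivative u' x) (at x within S)" if "x \<in> S" for x
    unfolding u_def u'_def using that \<sigma> N
    by (auto simp: S_def intro!: derivative_eq_intros)
  have inj: "inj_on u S"
  proof (rule inj_onI)
    fix x y assume *: "x \<in> S" "y \<in> S" "u x = u y"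
    hence "(e * (x - \<mu>)) powr N = (e * (y - \<mu>)) powr N"
      using \<sigma> by (simp add: u_def)
    hence "((e * (x - \<mu>)) powr N) powr (1 / N) = ((e * (y - \<mu>)) powr N) powr (1 / N)"
      by (rule arg_cong)
    hence "e * (x - \<mu>) = e * (y - \<mu>)"
      using * N by (simp add: powr_powr S_def)
    thus "x = y" using e by auto
  qed
  have img: "u ` S = {0<..}"
  proof (intro equalityI subsetI)
    fix t assume "t \<in> u ` S" thus "t \<in> {0<..}"
      using \<sigma> by (force simp: u_def S_def intro!: divide_pos_pos)
  next
    fix t :: real assume t: "t \<in> {0<..}"
    define x where "x = \<mu> + e * (\<sigma> * t powr (1 / N))"
    have "e * (x - \<mu>) = \<sigma> * t powr (1 / N)"
      using e by (auto simp: x_def)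
    hence "x \<in> S" "u x = t"
      using t \<sigma> N by (auto simp: S_def u_def powr_mult powr_powr)
    thus "t \<in> u ` S" by blast
  qed
  \<comment> \<open>The image of \<open>u\<close> is the open half line, so the point 0 is dropped
    from the domain of the Gamma integral.\<close>
  have "(f has_integral Gamma (2 - 1 / N)) {0<..}"
    unfolding f_def
  proof (rule has_integral_spike_set_eq[THEN iffD1, OF _ _ Gamma_integral_real[OF s]])
    show "negligible {x \<in> {0..} - {0<..}. x powr (2 - 1 / N - 1) / exp x \<noteq> 0}"
      by (rule negligible_subset[of "{0::real}"]) auto
    show "negligible {x \<in> {0<..} - {0..}. x powr (2 - 1 / N - 1) / exp x \<noteq> 0}"
      by (rule negligible_subset[of "{0::real}"]) auto
  qed
  moreover from this have "f absolutely_integrable_on {0<..}"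
    by (intro nonnegative_absolutely_integrable_1) (auto simp: f_def)
  \<comment> \<open>The Jacobian enters as \<open>\<bar>u' x\<bar>\<close>, so the increasing case
    \<open>e = 1\<close> and the decreasing case \<open>e = -1\<close> are handled at once.\<close>
  ultimately have "(\<lambda>x. \<bar>u' x\<bar> * f (u x)) absolutely_integrable_on S \<and>
      integral S (\<lambda>x. \<bar>u' x\<bar> * f (u x)) = Gamma (2 - 1 / N)"
    by (subst has_absolute_integral_change_of_variables_1'[OF S der inj])
      (simp_all add: img integral_unique)
  hence "((\<lambda>x. \<bar>u' x\<bar> * f (u x)) has_integral Gamma (2 - 1 / N)) S"
    by (auto intro!: integrable_integral dest: set_lebesgue_integral_eq_integral(1)
        simp: has_integral_iff)
  \<comment> \<open>The factor cancels the constant \<open>N / \<sigma> powr (2 * N - 1)\<close>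
    that the Jacobian and the power in \<open>f (u x)\<close> produce together.\<close>
  hence "((\<lambda>x. \<sigma> powr (2 * N - 1) / N * (\<bar>u' x\<bar> * f (u x))) has_integral
            \<sigma> powr (2 * N - 1) / N * Gamma (2 - 1 / N)) S"
    by (rule has_integral_mult_right)
  moreover have "\<sigma> powr (2 * N - 1) / N * (\<bar>u' x\<bar> * f (u x))
      = \<bar>x - \<mu>\<bar> powr (2 * N - 2) * exp (- (\<bar>x - \<mu>\<bar> powr N / \<sigma> powr N))" if x: "x \<in> S" for x
  proof -
    define y where "y = e * (x - \<mu>)"
    have y: "y > 0" "\<bar>x - \<mu>\<bar> = y" using x abs_eq by (auto simp: S_def y_def)
    have "\<bar>u' x\<bar> = N * y powr (N - 1) / \<sigma> powr N"
      using N abs_e by (simp add: u'_def y_def abs_mult)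
    moreover have "f (u x) = y powr (N - 1) / \<sigma> powr (N - 1) * exp (- (y powr N / \<sigma> powr N))"
    proof -
      have "N * (2 - 1 / N - 1) = N - 1" using N by (simp add: field_simps)
      thus ?thesis
        using y \<sigma> unfolding f_def u_def y_def[symmetric]
        by (simp add: powr_divide powr_powr exp_minus field_simps)
    qed
    moreover have "\<sigma> powr (2 * N - 1) = \<sigma> powr N * \<sigma> powr (N - 1)"
      by (simp add: powr_add[symmetric])
    moreover have "y powr (2 * N - 2) = y powr (N - 1) * y powr (N - 1)"
      by (simp add: powr_add[symmetric])
    ultimately show ?thesis
      using y N \<sigma> by simp
  qed
  ultimately show ?thesis
    unfolding S_def[symmetric] by (subst has_integral_cong[symmetric]) auto
qed

text \<open>Squaring the score removes its sign, so both half lines contribute the same integral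
  \<open>J\<close>. The result does not depend on \<open>\<mu>\<close>, hence the metric is
  constant.\<close>

lemma fisher_information_gen_gaussian_density:
  fixes N \<sigma> \<mu> :: real
  assumes N: "N > 1 / 2" and \<sigma>: "\<sigma> > 0"
  shows "fisher_information (gen_gaussian_density N \<sigma>) \<mu>
           = N * Gamma (2 - 1 / N) / Gamma (1 + 1 / N) / \<sigma>\<^sup>2"
proof -
  define p where "p = gen_gaussian_density N \<sigma> \<mu>"
  define d where "d x = deriv (\<lambda>m. ln (gen_gaussian_density N \<sigma> m x)) \<mu>" for x
  \<comment> \<open>The normalising constant of the density times the square of the constant factor
    of the score.\<close>
  define c where "c = N / (2 * \<sigma> * Gamma (1 / N)) * (N / \<sigma> powr N)\<^sup>2"
  define q where "q x = \<bar>x - \<mu>\<bar> powr (2 * N - 2) * exp (- (\<bar>x - \<mu>\<bar> powr N / \<sigma> powr N))" for x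
  define J where "J = \<sigma> powr (2 * N - 1) / N * Gamma (2 - 1 / N)"
  have G: "Gamma (1 / N) > 0"
    using N by (intro Gamma_real_pos) auto
  have p_nonneg: "p x \<ge> 0" for x
    using G N \<sigma> by (simp add: p_def gen_gaussian_density_def)
  have p_meas [measurable]: "p \<in> borel_measurable borel"
    unfolding p_def gen_gaussian_density_def[abs_def] by measurable
  \<comment> \<open>The unspecified value of \<open>deriv\<close> at \<open>\<mu>\<close> is kept as
    \<open>d \<mu>\<close>; it affects a single point, so measurability follows from the explicit
    formula elsewhere.\<close>
  have d_eq: "d = (\<lambda>x. if x = \<mu> then d \<mu> else
                 sgn (x - \<mu>) * N * \<bar>x - \<mu>\<bar> powr (N - 1) / \<sigma> powr N)"
    using deriv_ln_gen_gaussian_density[of N \<sigma>] N \<sigma> by (auto simp: d_def)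
  have d_meas [measurable]: "d \<in> borel_measurable borel"
    by (subst d_eq) measurable
  have "(q has_integral J) {x. 1 * (x - \<mu>) > 0}" "(q has_integral J) {x. -1 * (x - \<mu>) > 0}"
    unfolding q_def J_def by (intro has_integral_powr_exp_half_line N \<sigma>; simp)+
  hence "(q has_integral J + J) ({x. 1 * (x - \<mu>) > 0} \<union> {x. -1 * (x - \<mu>) > 0})"
    by (rule has_integral_Un) (rule negligible_subset[of "{}"], auto)
  hence "(q has_integral J + J) UNIV"
    by (rule has_integral_spike_set_eq[THEN iffD1, rotated 2])
      (rule negligible_subset[of "{\<mu>}"], auto)+
  hence "((\<lambda>x. c * q x) has_integral c * (J + J)) UNIV"
    by (rule has_integral_mult_right)
  hence "((\<lambda>x. p x * (d x)\<^sup>2) has_integral c * (J + J)) UNIV"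
  proof (rule has_integral_spike[of "{\<mu>}", rotated 2])
    fix x assume "x \<in> UNIV - {\<mu>}"
    hence x: "x \<noteq> \<mu>" by simp
    have "(\<bar>x - \<mu>\<bar> powr (N - 1))\<^sup>2 = \<bar>x - \<mu>\<bar> powr (2 * N - 2)"
      by (simp add: power2_eq_square powr_add[symmetric])
    moreover have "(sgn (x - \<mu>))\<^sup>2 = 1" using x by (simp add: sgn_if)
    ultimately show "p x * (d x)\<^sup>2 = c * q x"
      using x by (subst d_eq)
        (simp add: p_def gen_gaussian_density_def c_def q_def power_mult_distrib power_divide)
  qed simp
  \<comment> \<open>The gauge integral of a nonnegative function is passed to the Lebesgue integral
    through \<open>nn_integral\<close>; returning to a real value below requires the result to be
    nonnegative.\<close>
  hence "(\<integral>\<^sup>+x. ennreal (p x * (d x)\<^sup>2) \<partial>lborel) = ennreal (c * (J + J))"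
    using p_nonneg by (intro nn_integral_has_integral_lborel) auto
  moreover have cJ: "c * (J + J) = N * Gamma (2 - 1 / N) / Gamma (1 + 1 / N) / \<sigma>\<^sup>2"
  proof -
    have "Gamma (1 + 1 / N) = Gamma (1 / N) / N"
      using Gamma_plus1[of "1 / N"] N nonpos_Ints_nonpos[of "1 / N"] by (auto simp: add.commute)
    moreover have "(\<sigma> powr N)\<^sup>2 = \<sigma> * \<sigma> powr (2 * N - 1)"
      using \<sigma> by (simp add: power2_eq_square powr_add[symmetric] powr_mult_base)
    \<comment> \<open>Here \<open>A\<close>, \<open>B\<close> and \<open>t\<close> stand for
      \<open>Gamma (1 / N)\<close>, \<open>Gamma (2 - 1 / N)\<close> and
      \<open>\<sigma> powr (2 * N - 1)\<close>, which leaves a purely rational identity.\<close>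
    moreover have "N / (2 * \<sigma> * A) * (N\<^sup>2 / (\<sigma> * t)) * (t / N * B + t / N * B)
        = N * B / (A / N) / \<sigma>\<^sup>2" if "A > 0" "t > 0" for A B t :: real
      using N \<sigma> that by (simp add: field_simps power2_eq_square)
    ultimately show ?thesis
      using G \<sigma> by (simp only: c_def J_def power_divide powr_gt_zero)
  qed
  moreover have "N * Gamma (2 - 1 / N) / Gamma (1 + 1 / N) / \<sigma>\<^sup>2 \<ge> 0"
    using N \<sigma> by (intro divide_nonneg_nonneg mult_nonneg_nonneg less_imp_le[OF Gamma_real_pos])
      (auto simp: field_simps add_pos_pos)
  ultimately have "(\<integral>x. p x * (d x)\<^sup>2 \<partial>lborel)
      = N * Gamma (2 - 1 / N) / Gamma (1 + 1 / N) / \<sigma>\<^sup>2"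
    using p_nonneg by (subst integral_eq_nn_integral) auto
  moreover have "fisher_information (gen_gaussian_density N \<sigma>) \<mu> = (\<integral>x. p x * (d x)\<^sup>2 \<partial>lborel)"
    unfolding fisher_information_def p_def[symmetric] d_def[symmetric]
    using p_nonneg by (subst integral_density) auto
  ultimately show ?thesis by simp
qed

section \<open>Straight paths\<close>

lemma smooth_path_affine: "smooth_path (\<lambda>t. a + b * t)"
  unfolding smooth_path_def
proof
  fix k
  let ?D = "\<lambda>f t. vector_derivative f (at t within {0..1::real}) :: real"
  \<comment> \<open>Affine functions are closed under differentiation. The claim is confined to
    \<open>{0..1}\<close> because the iterated one-sided derivative is not controlled outside
    it.\<close>
  have "\<exists>a' b'. \<forall>t\<in>{0..1}. (?D ^^ k) (\<lambda>t. a + b * t) t = a' + b' * t"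
  proof (induction k)
    case 0
    show ?case by auto
  next
    case (Suc k)
    then obtain a' b' where eq: "\<And>t. t \<in> {0..1} \<Longrightarrow> (?D ^^ k) (\<lambda>t. a + b * t) t = a' + b' * t"
      by auto
    have "?D ((?D ^^ k) (\<lambda>t. a + b * t)) t = b'" if t: "t \<in> {0..1}" for t
    proof -
      have "((\<lambda>t. a' + b' * t) has_vector_derivative b') (at t within {0..1})"
        by (auto intro!: derivative_eq_intros)
      hence "((?D ^^ k) (\<lambda>t. a + b * t) has_vector_derivative b') (at t within {0..1})"
        by (rule has_vector_derivative_transform[OF t eq, rotated])
      thus ?thesis
        using vector_derivative_within_cbox[of 0 1 t] t by simp
    qed
    thus ?case by (intro exI[of _ b'] exI[of _ 0]) auto
  qed
  then obtain a' b' where eq: "\<And>t. t \<in> {0..1} \<Longrightarrow> (?D ^^ k) (\<lambda>t. a + b * t) t = a' + b' * t"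
    by auto
  have "(\<lambda>t. a' + b' * t) differentiable at t within {0..1}" for t :: real
    by (intro derivative_intros)
  from differentiable_transform_within[OF this zero_less_one _ eq[symmetric]]
  show "(?D ^^ k) (\<lambda>t. a + b * t) differentiable_on {0..1}"
    unfolding differentiable_on_def
    by blast
qed

lemma path_length_affine:
  assumes "\<And>x. g x = c"
  shows "path_length g (\<lambda>t. a + b * t) = sqrt c * \<bar>b\<bar>"
proof -
  have "vector_derivative (\<lambda>t. a + b * t) (at t within {0..1}) = b" if "t \<in> {0..1}" for t :: real
    using that by (intro vector_derivative_at_within_ivl) (auto intro!: derivative_eq_intros)
  hence "path_length g (\<lambda>t. a + b * t) = integral {0..1::real} (\<lambda>t. sqrt c * \<bar>b\<bar>)"
    unfolding path_length_def assms by (intro integral_cong) auto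
  thus ?thesis by simp
qed

text \<open>The straight segment from \<open>a\<close> to \<open>b\<close> competes in the infimum,
  and its length is the right-hand side.\<close>

lemma riemannian_distance_const_le:
  assumes "\<And>x. g x = c" and "c \<ge> 0"
  shows "riemannian_distance g a b \<le> sqrt c * \<bar>a - b\<bar>"
  unfolding riemannian_distance_def
proof (rule cInf_lower2)
  show "path_length g (\<lambda>t. a + (b - a) * t) \<in>
      {path_length g \<alpha> |\<alpha>. smooth_path \<alpha> \<and> \<alpha> 0 = a \<and> \<alpha> 1 = b}"
    using smooth_path_affine[of a "b - a"]
    by (intro CollectI exI[of _ "\<lambda>t. a + (b - a) * t"]) auto
  show "path_length g (\<lambda>t. a + (b - a) * t) \<le> sqrt c * \<bar>a - b\<bar>"
    using assms(1) by (subst path_length_affine) (auto simp: abs_minus_commute)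
  \<comment> \<open>\<open>Inf\<close> lies below its members only for a set bounded below. If the
    speed is not integrable, \<open>integral\<close> defaults to 0, so the bound 0 holds for every
    path.\<close>
  have "path_length g \<alpha> \<ge> 0" for \<alpha>
  proof (cases "(\<lambda>t. sqrt (g (\<alpha> t)) * \<bar>vector_derivative \<alpha> (at t within {0..1})\<bar>)
                  integrable_on {0..1}")
    case True
    thus ?thesis
      unfolding path_length_def by (rule integral_nonneg) (simp add: assms)
  next
    case False
    thus ?thesis by (simp add: path_length_def not_integrable_integral)
  qed
  thus "bdd_below {path_length g \<alpha> |\<alpha>. smooth_path \<alpha> \<and> \<alpha> 0 = a \<and> \<alpha> 1 = b}"
    by (intro bdd_belowI[of _ 0]) auto
qed

section \<open>Privacy of the generalized Gaussian mechanism\<close>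

theorem theorem4p12:
  fixes N \<sigma> \<theta> :: real and n :: nat and X :: "'a set" and h :: "'a list \<Rightarrow> real"
  assumes "N > 1 / 2"
    and "\<theta> > 0"
    and "\<sigma> > 0"
    and "ennreal \<sigma> \<ge> sensitivity n X h / ennreal \<theta>
           * ennreal (sqrt (N * Gamma (2 - 1 / N) / Gamma (1 + 1 / N)))"
  shows "rao_differentially_private n X (gen_gaussian_density N \<sigma>) \<theta>
           (gen_gaussian_mechanism N \<sigma> h)"
proof -
  define K where "K = N * Gamma (2 - 1 / N) / Gamma (1 + 1 / N)"
  have K: "K \<ge> 0"
    unfolding K_def using assms(1)
    by (intro divide_nonneg_nonneg mult_nonneg_nonneg less_imp_le[OF Gamma_real_pos])
      (auto simp: field_simps add_pos_pos)
  have mech: "gen_gaussian_mechanism N \<sigma> h D = gen_gaussian_density N \<sigma> (h D)" for D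
    by (rule ext) (simp add: gen_gaussian_mechanism_def)
  have inv: "inv (gen_gaussian_density N \<sigma>) (gen_gaussian_density N \<sigma> \<mu>) = \<mu>" for \<mu>
    using assms by (intro inv_f_f inj_gen_gaussian_density) auto
  have "rao_distance (gen_gaussian_density N \<sigma>) (gen_gaussian_mechanism N \<sigma> h D)
          (gen_gaussian_mechanism N \<sigma> h D') \<le> \<theta>"
    if D: "D \<in> datasets n X" "D' \<in> datasets n X" "adjacent D D'" for D D'
  proof -
    have "ennreal \<bar>h D - h D'\<bar> \<le> sensitivity n X h"
      unfolding sensitivity_def using D by (intro SUP_upper2[of "(D, D')"]) auto
    hence "ennreal \<bar>h D - h D'\<bar> / ennreal \<theta> * ennreal (sqrt K)
        \<le> sensitivity n X h / ennreal \<theta> * ennreal (sqrt K)"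
      by (intro mult_right_mono divide_right_mono_ennreal) auto
    also have "\<dots> \<le> ennreal \<sigma>"
      using assms(4) by (simp add: K_def)
    \<comment> \<open>Everything on the left is a finite nonnegative real, so the extended
      operations collapse to real ones and the bound becomes an inequality of reals.\<close>
    finally have "ennreal (\<bar>h D - h D'\<bar> / \<theta> * sqrt K) \<le> ennreal \<sigma>"
      using assms(2) K by (simp add: divide_ennreal ennreal_mult'' del: times_divide_eq_left)
    hence "\<bar>h D - h D'\<bar> / \<theta> * sqrt K \<le> \<sigma>"
      using assms(3) by simp
    hence "sqrt K / \<sigma> * \<bar>h D - h D'\<bar> \<le> \<theta>"
      using assms(2,3) by (simp add: field_simps)
    moreover have "sqrt (K / \<sigma>\<^sup>2) = sqrt K / \<sigma>"
      using assms(3) by (simp add: real_sqrt_divide)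
    moreover have "riemannian_distance (fisher_information (gen_gaussian_density N \<sigma>)) (h D) (h D')
        \<le> sqrt (K / \<sigma>\<^sup>2) * \<bar>h D - h D'\<bar>"
      using fisher_information_gen_gaussian_density[OF assms(1,3)]
        divide_nonneg_nonneg[OF K, of "\<sigma>\<^sup>2"]
      unfolding K_def by (intro riemannian_distance_const_le) simp_all
    ultimately show ?thesis
      unfolding rao_distance_def mech inv by simp
  qed
  thus ?thesis
    unfolding rao_differentially_private_def mech by auto
qed

end
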